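(* Let $E$ and $F$ be finite directed graphs with no sinks and let $\ell, c\in\mathbb{N}$. There is a one-to-one correspondence, given by $\psi\mapsto h_\psi$, between the collection of $(\ell,c)$-block maps $\psi\colon E^{1+\ell+c}\to F^{1+\ell}$ satisfying the bijectivity condition and the collection of $(\ell,c)$-conjugacies $h\colon E^\infty\to F^\infty$. For $c=0$, there is a one-to-one correspondence (again given by $\psi\mapsto h_\psi$) between the collection of bijective $(\ell,0)$-block maps $\psi\colon E^{1+\ell}\to F^{1+\ell}$ and the collection of $(\ell,0)$-conjugacies $h\colon E^\infty\to F^\infty$ whose inverses are also $(\ell,0)$-conjugacies.
   Context: $\mathbb{N}=\{0,1,2,\dots\}$. A directed graph $E=(E^0,E^1,r_E,s_E)$ consists of vertices $E^0$, edges $E^1$, and range and source maps $r_E,s_E\colon E^1\to E^0$; multiple edges and loops are allowed. A sink is a vertex $v$ with $s_E^{-1}(v)=\emptyset$; a source is a vertex with $r_E^{-1}(v)=\emptyset$ (sources are allowed). $E^n$ denotes the set of paths of $n$ edges (consecutive edges satisfy $r_E(\text{edge})=s_E(\text{next edge})$). The path space is $E^\infty=\{x\in (E^1)^{\mathbb{N}} : r_E(x_i)=s_E(x_{i+1}),\ i\in\mathbb{N}\}$ with the subspace topology of the product topology ($E^1$ discrete), and $\sigma_E\colon E^\infty\to E^\infty$, $\sigma_E(x)_i=x_{i+1}$, is the shift. For $x\in E^\infty$ and $0\le i\le j$, $x_{[i,j]}=x_ix_{i+1}\cdots x_j$. For a finite path $\mu$ of $n$ edges, $Z_E(\mu)=\{x\in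 E^\infty: x_{[0,n-1]}=\mu\}$. In what follows edges of a path in $F^{1+\ell}$ are indexed $0,\dots,\ell$. An $\ell$-sliding block code is a continuous map $h\colon E^\infty\to F^\infty$ with $\sigma_F^{\ell+1}(h(x))=\sigma_F^{\ell}(h(\sigma_E(x)))$ for all $x\in E^\infty$. A number $c\in\mathbb{N}$ is a continuity constant for $h$ (relative to $\ell$) if $h(Z_E(x_{[0,k+c]}))\subseteq Z_F(h(x)_{[0,k]})$ for all $k\ge\ell$ and $x\in E^\infty$. An $(\ell,c)$-sliding block code is an $\ell$-sliding block code for which $c$ is a continuity constant relative to $\ell$; an $(\ell,c)$-conjugacy is a bijective $(\ell,c)$-sliding block code. An $(\ell,c)$-block map is a map $\psi\colon E^{1+\ell+c}\to F^{1+\ell}$ that is compatible with $E$ and $F$, i.e. $\psi(x_{[0,\ell+c]})_\ell\,\psi(x_{[1,1+\ell+c]})_\ell\in F^2$ for all $x\in E^\infty$. Such $\psi$ extends to $\psi\colon E^{1+\ell+c+i}\to F^{1+\ell+i}$ for every $i\in\mathbb{N}$ by $\psi(x_{[0,\ell+c+i]})=\psi(x_{[0,\ell+c]})\,\psi(x_{[1,\ell+c+1]})_\ell\cdots\psi(x_{[i,\ell+c+i]})_\ell$, and to a map $h_\psi\colon E^\infty\to F^\infty$ by $h_\psi(x)=\psi(x_{[0,\ell+c]})\,\psi(x_{[1,\ell+c+1]})_\ell\cdots\psi(x_{[i,\ell+c+i]})_\ell\cdots$. $\psi$ satisfies the surjectivity condition if for every $k\ge\ell$ and every $\beta\in F^{1+k}$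 there is $\alpha\in E^{1+k+c}$ with $\psi(\alpha)=\beta$. $\psi$ satisfies the injectivity condition if for every $k\ge\ell$ there is $K\in\mathbb{N}$ (with $k+K\ge\ell+c$, so that the extension is defined) such that for all $x,x'\in E^\infty$, $\psi(x_{[0,k+K]})=\psi(x'_{[0,k+K]})$ implies $x_{[0,k]}=x'_{[0,k]}$. $\psi$ satisfies the bijectivity condition if it satisfies both.
   Formalization: In the second claim "bijective (ℓ,0)-block map" means that ψ is a bijection, ψ^{-1} is also an (ℓ,0)-block map, and the extensions of ψ and ψ^{-1} to all longer paths are mutually inverse; with bijectivity on E^{1+ℓ} alone the claim is false. *)

theory Defs
  imports "HOL-Analysis.Function_Topology" "Graph_Theory.Arc_Walk"
begin

text \<open>
  A directed graph is a \<^typ>\<open>('a,'b) pre_digraph\<close> satisfying \<^const>\<open>fin_digraph\<close>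
  (loops and multiple edges are allowed); the source map is \<^const>\<open>tail\<close>, the range map
  is \<^const>\<open>head\<close>.
\<close>

definition no_sinks :: "('a,'b) pre_digraph \<Rightarrow> bool" where
  "no_sinks E \<longleftrightarrow> (\<forall>v\<in>verts E. out_arcs E v \<noteq> {})"

text \<open>
  The set of paths with \<open>n\<close> edges, for \<open>n \<ge> 1\<close>. (For \<open>n = 0\<close> one would want the
  vertices instead; this case is never used.)
\<close>

definition paths :: "('a,'b) pre_digraph \<Rightarrow> nat \<Rightarrow> 'b list set" where
  "paths E n = {p. length p = n \<and> (\<exists>u v. pre_digraph.awalk E u p v)}"

definition path_space :: "('a,'b) pre_digraph \<Rightarrow> (nat \<Rightarrow> 'b) set" where
  "path_space E = {x. \<forall>i. x i \<in> arcs E \<and> head E (x i) = tail E (x (Suc i))}"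

definition path_topology :: "('a,'b) pre_digraph \<Rightarrow> (nat \<Rightarrow> 'b) topology" where
  "path_topology E =
     subtopology (product_topology (\<lambda>_. discrete_topology (arcs E)) UNIV) (path_space E)"

definition shift :: "(nat \<Rightarrow> 'b) \<Rightarrow> nat \<Rightarrow> 'b" where
  "shift x = (\<lambda>i. x (Suc i))"

definition segment :: "(nat \<Rightarrow> 'b) \<Rightarrow> nat \<Rightarrow> nat \<Rightarrow> 'b list" where
  "segment x i j = map x [i..<Suc j]"

definition cylinder :: "('a,'b) pre_digraph \<Rightarrow> 'b list \<Rightarrow> (nat \<Rightarrow> 'b) set" where
  "cylinder E \<mu> = {x \<in> path_space E. map x [0..<length \<mu>] = \<mu>}"

text \<open>
  Maps between path spaces, and block maps, are represented by functions that are
  \<^const>\<open>undefined\<close> outside their domain, so that they are equal iff they agree on it.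
\<close>

definition sliding_block_code ::
  "nat \<Rightarrow> ('a,'b) pre_digraph \<Rightarrow> ('c,'d) pre_digraph \<Rightarrow> ((nat \<Rightarrow> 'b) \<Rightarrow> nat \<Rightarrow> 'd) \<Rightarrow> bool" where
  "sliding_block_code l E F h \<longleftrightarrow>
     h \<in> path_space E \<rightarrow>\<^sub>E path_space F \<and>
     continuous_map (path_topology E) (path_topology F) h \<and>
     (\<forall>x\<in>path_space E. (shift ^^ (l + 1)) (h x) = (shift ^^ l) (h (shift x)))"

definition continuity_constant ::
  "nat \<Rightarrow> nat \<Rightarrow> ('a,'b) pre_digraph \<Rightarrow> ('c,'d) pre_digraph \<Rightarrow>
     ((nat \<Rightarrow> 'b) \<Rightarrow> nat \<Rightarrow> 'd) \<Rightarrow> bool" where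
  "continuity_constant l c E F h \<longleftrightarrow>
     (\<forall>k\<ge>l. \<forall>x\<in>path_space E.
        h ` cylinder E (segment x 0 (k + c)) \<subseteq> cylinder F (segment (h x) 0 k))"

definition conjugacy ::
  "nat \<Rightarrow> nat \<Rightarrow> ('a,'b) pre_digraph \<Rightarrow> ('c,'d) pre_digraph \<Rightarrow>
     ((nat \<Rightarrow> 'b) \<Rightarrow> nat \<Rightarrow> 'd) \<Rightarrow> bool" where
  "conjugacy l c E F h \<longleftrightarrow>
     sliding_block_code l E F h \<and> continuity_constant l c E F h \<and>
     bij_betw h (path_space E) (path_space F)"

definition inverse_map ::
  "('a,'b) pre_digraph \<Rightarrow> ('c,'d) pre_digraph \<Rightarrow> ((nat \<Rightarrow> 'b) \<Rightarrow> nat \<Rightarrow> 'd) \<Rightarrow>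
     (nat \<Rightarrow> 'd) \<Rightarrow> nat \<Rightarrow> 'b" where
  "inverse_map E F h = restrict (inv_into (path_space E) h) (path_space F)"

definition block_map ::
  "nat \<Rightarrow> nat \<Rightarrow> ('a,'b) pre_digraph \<Rightarrow> ('c,'d) pre_digraph \<Rightarrow> ('b list \<Rightarrow> 'd list) \<Rightarrow> bool" where
  "block_map l c E F \<psi> \<longleftrightarrow>
     \<psi> \<in> paths E (1 + l + c) \<rightarrow>\<^sub>E paths F (1 + l) \<and>
     (\<forall>x\<in>path_space E.
        [\<psi> (segment x 0 (l + c)) ! l, \<psi> (segment x 1 (1 + l + c)) ! l] \<in> paths F 2)"

text \<open>The extension of \<open>\<psi>\<close> to paths \<open>\<alpha>\<close> with \<open>1 + l + c + i\<close> edges, for all \<open>i\<close> at once.\<close>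

definition block_ext :: "nat \<Rightarrow> nat \<Rightarrow> ('b list \<Rightarrow> 'd list) \<Rightarrow> 'b list \<Rightarrow> 'd list" where
  "block_ext l c \<psi> \<alpha> =
     \<psi> (take (1 + l + c) \<alpha>) @
     map (\<lambda>j. \<psi> (take (1 + l + c) (drop j \<alpha>)) ! l) [1..<length \<alpha> - (l + c)]"

text \<open>The map \<open>h\<^sub>\<psi>\<close>: the letter contributed by the window starting at \<open>j\<close> has index \<open>l + j\<close>.\<close>

definition block_code ::
  "nat \<Rightarrow> nat \<Rightarrow> ('a,'b) pre_digraph \<Rightarrow> ('b list \<Rightarrow> 'd list) \<Rightarrow> (nat \<Rightarrow> 'b) \<Rightarrow> nat \<Rightarrow> 'd" where
  "block_code l c E \<psi> =
     (\<lambda>x\<in>path_space E. \<lambda>i.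
        if i \<le> l then \<psi> (segment x 0 (l + c)) ! i
        else \<psi> (segment x (i - l) (i + c)) ! l)"

definition surjectivity_condition ::
  "nat \<Rightarrow> nat \<Rightarrow> ('a,'b) pre_digraph \<Rightarrow> ('c,'d) pre_digraph \<Rightarrow> ('b list \<Rightarrow> 'd list) \<Rightarrow> bool" where
  "surjectivity_condition l c E F \<psi> \<longleftrightarrow>
     (\<forall>k\<ge>l. \<forall>\<beta>\<in>paths F (1 + k). \<exists>\<alpha>\<in>paths E (1 + k + c). block_ext l c \<psi> \<alpha> = \<beta>)"

definition injectivity_condition ::
  "nat \<Rightarrow> nat \<Rightarrow> ('a,'b) pre_digraph \<Rightarrow> ('b list \<Rightarrow> 'd list) \<Rightarrow> bool" where
  "injectivity_condition l c E \<psi> \<longleftrightarrow>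
     (\<forall>k\<ge>l. \<exists>K. l + c \<le> k + K \<and>
        (\<forall>x\<in>path_space E. \<forall>x'\<in>path_space E.
           block_ext l c \<psi> (segment x 0 (k + K)) = block_ext l c \<psi> (segment x' 0 (k + K)) \<longrightarrow>
           segment x 0 k = segment x' 0 k))"

definition bijectivity_condition ::
  "nat \<Rightarrow> nat \<Rightarrow> ('a,'b) pre_digraph \<Rightarrow> ('c,'d) pre_digraph \<Rightarrow> ('b list \<Rightarrow> 'd list) \<Rightarrow> bool" where
  "bijectivity_condition l c E F \<psi> \<longleftrightarrow>
     surjectivity_condition l c E F \<psi> \<and> injectivity_condition l c E \<psi>"

text \<open>
  Bijective \<open>(l,0)\<close>-block maps are the block maps that are bijective on the paths with
  \<open>1 + l\<close> edges and whose inverse is a block map too, its extension to longer paths being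
  inverse to the extension of \<open>\<psi>\<close>. Bijectivity on the paths with \<open>1 + l\<close> edges does not
  imply the rest, nor that \<open>h\<^sub>\<psi>\<close> is a conjugacy: for \<open>l = 0\<close> let \<open>E\<close> have two vertices
  with one loop each and \<open>F\<close> one vertex with two loops; a bijection of the edges is a
  block map, but \<open>h\<^sub>\<psi>\<close> is not surjective. Nor is it enough that the extensions of \<open>\<psi>\<close>
  are bijective for all lengths: for \<open>l = 1\<close> and \<open>E = F\<close> one vertex with two loops 0, 1,
  take \<open>\<psi>(ab) = a(a+b)\<close> modulo 2. Here \<open>h\<^sub>\<psi>\<close> is bijective, with inverse sending \<open>y\<close> to
  its partial sums, which is not a sliding block code.
\<close>

definition bijective_block_map ::
  "nat \<Rightarrow> ('a,'b) pre_digraph \<Rightarrow> ('c,'d) pre_digraph \<Rightarrow> ('b list \<Rightarrow> 'd list) \<Rightarrow> bool" where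
  "bijective_block_map l E F \<psi> \<longleftrightarrow>
     block_map l 0 E F \<psi> \<and>
     bij_betw \<psi> (paths E (1 + l)) (paths F (1 + l)) \<and>
     (let \<phi> = restrict (inv_into (paths E (1 + l)) \<psi>) (paths F (1 + l)) in
        block_map l 0 F E \<phi> \<and>
        (\<forall>i. (\<forall>\<alpha>\<in>paths E (1 + l + i). block_ext l 0 \<phi> (block_ext l 0 \<psi> \<alpha>) = \<alpha>) \<and>
             (\<forall>\<beta>\<in>paths F (1 + l + i). block_ext l 0 \<psi> (block_ext l 0 \<phi> \<beta>) = \<beta>)))"

end

theory Submission
  imports Defs "HOL-Analysis.Abstract_Topological_Spaces"
begin

text \<open>
  Both correspondences are restrictions of a single one. In a graph without sinks, every
  finite path is a prefix of an infinite one (\<open>path_is_prefix\<close>), so a block map amounts to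
  a function of the first \<open>1 + l + c\<close> edges of an infinite path, subject to compatibility. For
  a sliding block code \<open>h\<close> with continuity constant \<open>c\<close>, the first \<open>1 + l\<close> edges of \<open>h(x)\<close>
  are such a function of \<open>x\<close>, and commutation with the shift determines all the other edges from it. Hence
  \<open>\<psi> \<mapsto> h\<^sub>\<psi>\<close> is a bijection from all \<open>(l,c)\<close>-block maps to all \<open>(l,c)\<close>-sliding block codes
  (\<open>bij_betw_block_code\<close>). It remains to translate the extra properties on either side, and
  for this the key is that extending \<open>\<psi>\<close> to a prefix of \<open>x\<close> gives a prefix of \<open>h\<^sub>\<psi>(x)\<close>
  (\<open>block_ext_segment\<close>).

  The bijectivity condition on \<open>\<psi>\<close> is bijectivity of \<open>h\<^sub>\<psi>\<close>, stated on prefixes. Passing from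
  prefixes to infinite paths and back is immediate in two of the four implications; the other
  two use that finitely many edges make the path space compact. If \<open>h\<^sub>\<psi>\<close> attains every prefix
  of \<open>y\<close>, it attains \<open>y\<close> (\<open>surj_from_prefixes\<close>). If \<open>h\<^sub>\<psi>\<close> is injective, then each prefix of
  \<open>x\<close> can be read off from a prefix of \<open>h\<^sub>\<psi>(x)\<close> whose length does not depend on \<open>x\<close>
  (\<open>inj_recovers_prefix\<close>): this is uniform continuity of the inverse.

  For \<open>c = 0\<close>, the code of a block map \<open>\<psi>\<close> has an \<open>(l,0)\<close>-conjugacy as its inverse iff
  \<open>h\<^sub>\<psi>\<close> and \<open>h\<^sub>\<phi>\<close> are mutually inverse for some \<open>(l,0)\<close>-block map \<open>\<phi>\<close>. Comparing
  prefixes, this says that the extensions of \<open>\<psi>\<close> and \<open>\<phi>\<close> are mutually inverse in every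
  length, and no compactness is involved.
\<close>

section \<open>Paths as prefixes of infinite paths\<close>

lemma segment_nth: "i \<le> n \<Longrightarrow> segment x m (m + n) ! i = x (m + i)"
  by (simp add: segment_def del: upt_Suc)

lemma length_segment [simp]: "length (segment x i j) = Suc j - i"
  by (simp add: segment_def del: upt_Suc)

lemma segment_eq_iff: "segment x 0 n = segment y 0 n \<longleftrightarrow> (\<forall>i\<le>n. x i = y i)"
  by (auto simp: segment_def list_eq_iff_nth_eq less_Suc_eq_le simp del: upt_Suc)

lemma segment_eq_mono: "segment x 0 n = segment y 0 n \<Longrightarrow> m \<le> n \<Longrightarrow> segment x 0 m = segment y 0 m"
  by (simp add: segment_eq_iff)

lemma take_drop_segment:
  assumes "j + n \<le> m"
  shows "take (Suc n) (drop j (segment x 0 m)) = segment x j (j + n)"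
  using assms by (intro nth_equalityI) (auto simp: segment_def simp del: upt_Suc)

lemma shift_funpow: "(shift ^^ j) x = (\<lambda>i. x (i + j))"
  by (induction j arbitrary: x) (auto simp: shift_def)

lemma segment_shift_funpow: "segment ((shift ^^ j) x) 0 n = segment x j (j + n)"
  by (intro nth_equalityI) (auto simp: segment_def shift_funpow add.commute simp del: upt_Suc)

lemma shift_funpow_in_path_space: "x \<in> path_space E \<Longrightarrow> (shift ^^ j) x \<in> path_space E"
  by (auto simp: path_space_def shift_funpow)

lemma paths_Cons_iff:
  assumes "wf_digraph E"
  shows "e # es \<in> paths E (Suc n) \<longleftrightarrow>
    e \<in> arcs E \<and> (if n = 0 then es = [] else head E e = tail E (hd es) \<and> es \<in> paths E n)"
proof -
  interpret wf_digraph E by fact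
  \<comment> \<open>Here the walk relation appears without its last argument, where its own equations do not apply.\<close>
  have Ex_cas: "Ex (cas u []) \<longleftrightarrow> True" "Ex (cas u (a # as)) \<longleftrightarrow> tail E a = u \<and> Ex (cas (head E a) as)"
    for u a as
    by auto
  show ?thesis
    by (cases es) (auto simp: paths_def awalk_def Ex_cas simp del: cas.simps)
qed

lemma paths_Suc_iff:
  assumes "wf_digraph E"
  shows "p \<in> paths E (Suc n) \<longleftrightarrow> length p = Suc n \<and> (\<forall>i\<le>n. p ! i \<in> arcs E) \<and>
    (\<forall>i<n. head E (p ! i) = tail E (p ! Suc i))"
proof (induction n arbitrary: p)
  case 0
  show ?case
    by (cases p) (auto simp: paths_Cons_iff[OF assms], auto simp: paths_def)
next
  case (Suc n)
  show ?case
  proof (cases p)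
    case Nil
    then show ?thesis by (auto simp: paths_def)
  next
    case (Cons e es)
    have "(\<forall>i\<le>Suc n. p ! i \<in> arcs E) \<longleftrightarrow> e \<in> arcs E \<and> (\<forall>i\<le>n. es ! i \<in> arcs E)"
      using All_less_Suc2[of "Suc n" "\<lambda>i. p ! i \<in> arcs E"] Cons by (simp add: less_Suc_eq_le)
    moreover have "(\<forall>i<Suc n. head E (p ! i) = tail E (p ! Suc i)) \<longleftrightarrow>
        head E e = tail E (es ! 0) \<and> (\<forall>i<n. head E (es ! i) = tail E (es ! Suc i))"
      using All_less_Suc2[of n "\<lambda>i. head E (p ! i) = tail E (p ! Suc i)"] Cons by simp
    moreover have "p \<in> paths E (Suc (Suc n)) \<longleftrightarrow>
        e \<in> arcs E \<and> head E e = tail E (hd es) \<and> es \<in> paths E (Suc n)"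
      unfolding Cons paths_Cons_iff[OF assms] by simp
    moreover have "length p = Suc (Suc n) \<longleftrightarrow> length es = Suc n"
      using Cons by simp
    moreover have "hd es = es ! 0" if "length es = Suc n"
      using that by (cases es) auto
    ultimately show ?thesis
      using Suc[of es] by metis
  qed
qed

lemma segment_in_paths:
  assumes "wf_digraph E" "x \<in> path_space E"
  shows "segment x i (i + n) \<in> paths E (Suc n)"
  using assms by (auto simp: paths_Suc_iff segment_nth path_space_def)

text \<open>
  This is where the absence of sinks enters. It makes finite paths and prefixes of infinite
  paths the same thing, so that a block map is determined by its values on prefixes.
\<close>

lemma path_is_prefix:
  assumes "wf_digraph E" "no_sinks E" "p \<in> paths E (Suc n)"
  obtains x where "x \<in> path_space E" "segment x 0 n = p"
proof -
  have p: "length p = Suc n" "\<And>i. i \<le> n \<Longrightarrow> p ! i \<in> arcs E"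
    "\<And>i. i < n \<Longrightarrow> head E (p ! i) = tail E (p ! Suc i)"
    using assms by (auto simp: paths_Suc_iff)
  have "\<exists>f. f \<in> arcs E \<and> tail E f = head E e" if "e \<in> arcs E" for e
    using assms(2) wf_digraph.head_in_verts[OF assms(1) that]
    by (fastforce simp: no_sinks_def out_arcs_def)
  then obtain nxt where nxt: "\<And>e. e \<in> arcs E \<Longrightarrow> nxt e \<in> arcs E \<and> tail E (nxt e) = head E e"
    by metis
  define x where "x i = (if i \<le> n then p ! i else (nxt ^^ (i - n)) (p ! n))" for i
  have in_arcs: "(nxt ^^ k) (p ! n) \<in> arcs E" for k
    by (induction k) (use p nxt in auto)
  have "head E (x i) = tail E (x (Suc i))" for i
    using p nxt in_arcs by (cases i n rule: linorder_cases) (auto simp: x_def Suc_diff_le)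
  then have "x \<in> path_space E"
    using p in_arcs by (auto simp: path_space_def x_def)
  moreover have "segment x 0 n = p"
    using p(1) by (intro nth_equalityI) (auto simp: segment_def x_def simp del: upt_Suc)
  ultimately show thesis by (rule that)
qed

section \<open>Topology of the path space\<close>

lemma topspace_path_topology [simp]: "topspace (path_topology E) = path_space E"
  by (auto simp: path_topology_def path_space_def)

lemma continuous_map_coordinate:
  "continuous_map (path_topology E) (discrete_topology (arcs E)) (\<lambda>x. x i)"
  unfolding path_topology_def
  by (intro continuous_map_from_subtopology continuous_map_product_projection) simp

lemma openin_prefix_class:
  "openin (path_topology E) {x \<in> path_space E. segment x 0 n = w}"
proof (cases "\<exists>y \<in> path_space E. segment y 0 n = w")
  case True
  then obtain y where y: "y \<in> path_space E" "segment y 0 n = w" by blast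
  have "openin (path_topology E) {x \<in> topspace (path_topology E). x i \<in> {y i}}" for i
    using y(1) by (intro openin_continuous_map_preimage[OF continuous_map_coordinate])
      (auto simp: path_space_def)
  then have "openin (path_topology E)
      ((\<Inter>i\<in>{..n}. {x \<in> topspace (path_topology E). x i \<in> {y i}}) \<inter> topspace (path_topology E))"
    by (intro openin_INT) auto
  moreover have "(\<Inter>i\<in>{..n}. {x \<in> topspace (path_topology E). x i \<in> {y i}}) \<inter>
      topspace (path_topology E) = {x \<in> path_space E. segment x 0 n = w}"
    unfolding y(2)[symmetric] segment_eq_iff by auto
  ultimately show ?thesis by simp
next
  case False
  then have "{x \<in> path_space E. segment x 0 n = w} = {}" by blast
  then show ?thesis by (simp only: openin_empty)
qed

lemma continuous_map_prefix_determined: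
  assumes "\<And>x. x \<in> path_space E \<Longrightarrow> f x \<in> S"
    and "\<And>x y. \<lbrakk>x \<in> path_space E; y \<in> path_space E; segment x 0 n = segment y 0 n\<rbrakk> \<Longrightarrow> f x = f y"
  shows "continuous_map (path_topology E) (discrete_topology S) f"
proof -
  have "openin (path_topology E) {x \<in> path_space E. f x \<in> U}" for U
  proof (subst openin_subopen, intro ballI)
    fix x assume x: "x \<in> {x \<in> path_space E. f x \<in> U}"
    let ?T = "{y \<in> path_space E. segment y 0 n = segment x 0 n}"
    have "f y \<in> U" if "y \<in> ?T" for y
      using assms(2)[of x y] x that by simp
    then have "x \<in> ?T" "?T \<subseteq> {x \<in> path_space E. f x \<in> U}"
      using x by auto
    then show "\<exists>T. openin (path_topology E) T \<and> x \<in> T \<and> T \<subseteq> {x \<in> path_space E. f x \<in> U}"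
      using openin_prefix_class by blast
  qed
  then show ?thesis
    using assms(1) by (auto simp: continuous_map_def)
qed

lemma continuous_map_segment:
  "continuous_map (path_topology E) (discrete_topology UNIV) (\<lambda>x. segment x 0 n)"
  by (rule continuous_map_prefix_determined) auto

text \<open>
  Finitely many edges make the full shift compact; being a path is the closed condition
  that the range of each edge is the source of the next.
\<close>

lemma compact_space_path_topology:
  fixes E :: "('a,'b) pre_digraph"
  assumes "finite (arcs E)"
  shows "compact_space (path_topology E)"
proof -
  let ?P = "product_topology (\<lambda>_. discrete_topology (arcs E)) (UNIV :: nat set)"
  have "compact_space ?P"
    using assms by (simp add: compact_space_product_topology compact_space_discrete_topology)
  moreover have "closedin ?P (path_space E)"
  proof -
    have arc: "continuous_map ?P (discrete_topology UNIV) (\<lambda>x. f (x i))" for f :: "'b \<Rightarrow> 'a" and i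
    proof -
      have "continuous_map ?P (discrete_topology UNIV) (f \<circ> (\<lambda>x. x i))"
        by (rule continuous_map_compose[OF continuous_map_product_projection]) auto
      then show ?thesis by (simp add: comp_def)
    qed
    have "closedin ?P {x \<in> topspace ?P. head E (x i) = tail E (x (Suc i))}" for i
      by (rule closedin_continuous_maps_eq[OF Hausdorff_space_discrete_topology arc arc])
    then have "closedin ?P (\<Inter>i. {x \<in> topspace ?P. head E (x i) = tail E (x (Suc i))})"
      by (intro closedin_Inter) auto
    also have "(\<Inter>i. {x \<in> topspace ?P. head E (x i) = tail E (x (Suc i))}) = path_space E"
      by (auto simp: path_space_def PiE_UNIV_domain)
    finally show ?thesis .
  qed
  ultimately show ?thesis
    unfolding path_topology_def
    by (intro compact_space_subtopology closedin_compact_space)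
qed

lemma closedin_segment_image:
  assumes "continuous_map (path_topology E) (path_topology F) h"
  shows "closedin (path_topology E) {x \<in> path_space E. segment (h x) 0 n = w}"
  using closedin_continuous_map_preimage[
      OF continuous_map_compose[OF assms continuous_map_segment], of "{w}" n]
  by simp

section \<open>Compactness arguments\<close>

text \<open>
  If arbitrarily long prefixes of \<open>y\<close> are attained, the paths attaining them form a
  decreasing sequence of nonempty compact sets, and a common element is mapped to \<open>y\<close>.
\<close>

lemma surj_from_prefixes:
  assumes "finite (arcs E)"
    and cont: "continuous_map (path_topology E) (path_topology F) h"
    and prefixes: "\<And>k. l \<le> k \<Longrightarrow> \<exists>x\<in>path_space E. segment (h x) 0 k = segment y 0 k"
  obtains x where "x \<in> path_space E" "h x = y"
proof -
  define C where "C k = {x \<in> path_space E. segment (h x) 0 (l + k) = segment y 0 (l + k)}" for k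
  have "(\<Inter>k. C k) \<noteq> {}"
  proof (rule compact_space_imp_nest[OF compact_space_path_topology[OF assms(1)]])
    show "closedin (path_topology E) (C k)" for k
      unfolding C_def by (rule closedin_segment_image[OF cont])
    show "C k \<noteq> {}" for k
      using prefixes[of "l + k"] by (auto simp: C_def)
    show "decseq C"
      by (auto simp: decseq_def C_def elim: segment_eq_mono)
  qed
  then obtain x where x: "\<And>k. x \<in> C k" by blast
  have "h x i = y i" for i
    using x[of i] by (auto simp: C_def segment_eq_iff)
  then have "h x = y" by blast
  then show thesis using x that by (auto simp: C_def)
qed

text \<open>
  Otherwise, for every \<open>n\<close> some pair of paths has images that agree on the edges \<open>0, \<dots>, n\<close>
  but differs itself on the edges \<open>0, \<dots>, k\<close>. Such pairs form a decreasing sequence of nonempty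
  compact sets; a common element would be a pair of distinct paths with the same image.
\<close>

lemma inj_recovers_prefix:
  assumes "finite (arcs E)"
    and cont: "continuous_map (path_topology E) (path_topology F) h"
    and inj: "inj_on h (path_space E)"
  obtains n where "\<And>x x'. \<lbrakk>x \<in> path_space E; x' \<in> path_space E;
      segment (h x) 0 n = segment (h x') 0 n\<rbrakk> \<Longrightarrow> segment x 0 k = segment x' 0 k"
proof -
  let ?T = "prod_topology (path_topology E) (path_topology E)"
  define C where "C n = {p \<in> path_space E \<times> path_space E.
      segment (h (fst p)) 0 n = segment (h (snd p)) 0 n \<and>
      segment (fst p) 0 k \<noteq> segment (snd p) 0 k}" for n
  have comp: "compact_space ?T"
    by (simp add: compact_space_prod_topology compact_space_path_topology[OF assms(1)])
  have pair: "continuous_map ?T (discrete_topology UNIV) (\<lambda>p. (f (fst p), f (snd p)))"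
    if "continuous_map (path_topology E) (discrete_topology UNIV) f" for f :: "_ \<Rightarrow> 'z list"
  proof -
    have "continuous_map ?T (prod_topology (discrete_topology UNIV) (discrete_topology UNIV))
        (\<lambda>p. (f (fst p), f (snd p)))"
      using continuous_map_compose[OF continuous_map_fst that]
        continuous_map_compose[OF continuous_map_snd that]
      by (intro continuous_map_pairedI) (auto simp: comp_def)
    then show ?thesis by (simp flip: prod_topology_discrete_topology)
  qed
  \<comment> \<open>Both conditions on a pair depend continuously on it with values in a discrete space: one asks
    for a value on the diagonal, the other for a value off the diagonal.\<close>
  have closed: "closedin ?T (C n)" for n
  proof -
    have h: "continuous_map (path_topology E) (discrete_topology UNIV) (\<lambda>x. segment (h x) 0 n)"
      using continuous_map_compose[OF cont continuous_map_segment] by (simp add: comp_def)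
    have "closedin ?T {p \<in> topspace ?T. (segment (h (fst p)) 0 n, segment (h (snd p)) 0 n) \<in> Id}"
      by (rule closedin_continuous_map_preimage[OF pair[OF h]]) simp
    moreover have "closedin ?T {p \<in> topspace ?T. (segment (fst p) 0 k, segment (snd p) 0 k) \<in> - Id}"
      by (rule closedin_continuous_map_preimage[OF pair[OF continuous_map_segment]]) simp
    ultimately have "closedin ?T
        ({p \<in> topspace ?T. (segment (h (fst p)) 0 n, segment (h (snd p)) 0 n) \<in> Id} \<inter>
         {p \<in> topspace ?T. (segment (fst p) 0 k, segment (snd p) 0 k) \<in> - Id})"
      by (rule closedin_Int)
    also have "\<dots> = C n" by (auto simp: C_def)
    finally show ?thesis .
  qed
  have dec: "decseq C"
    by (auto simp: decseq_def C_def elim: segment_eq_mono)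
  have "\<exists>n. C n = {}"
  proof (rule ccontr)
    assume "\<nexists>n. C n = {}"
    then have "(\<Inter>n. C n) \<noteq> {}"
      by (intro compact_space_imp_nest[OF comp closed _ dec]) auto
    then obtain p where p: "\<And>n. p \<in> C n" by blast
    have "h (fst p) i = h (snd p) i" for i
      using p[of i] by (auto simp: C_def segment_eq_iff)
    then have "h (fst p) = h (snd p)" by blast
    then have "fst p = snd p"
      using inj p[of 0] by (auto simp: C_def inj_on_def mem_Times_iff)
    then show False using p[of 0] by (simp add: C_def)
  qed
  then obtain n where n: "C n = {}" ..
  show thesis
  proof (rule that)
    fix x x' assume "x \<in> path_space E" "x' \<in> path_space E"
      "segment (h x) 0 n = segment (h x') 0 n"
    moreover have "(x, x') \<notin> C n" using n by simp
    ultimately show "segment x 0 k = segment x' 0 k" by (simp add: C_def)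
  qed
qed

section \<open>Block maps and sliding block codes\<close>

lemma block_map_paths:
  "block_map l c E F \<psi> \<Longrightarrow> p \<in> paths E (Suc (l + c)) \<Longrightarrow> \<psi> p \<in> paths F (Suc l)"
  by (auto simp: block_map_def)

lemma block_code_shift:
  assumes "x \<in> path_space E"
  shows "block_code l c E \<psi> x (l + j) = \<psi> (segment x j (j + (l + c))) ! l"
  using assms by (auto simp: block_code_def add.assoc add.left_commute)

lemma segment_block_code:
  assumes "wf_digraph E" "block_map l c E F \<psi>" "x \<in> path_space E"
  shows "segment (block_code l c E \<psi> x) 0 l = \<psi> (segment x 0 (l + c))"
proof (rule nth_equalityI)
  have "length (\<psi> (segment x 0 (l + c))) = Suc l"
    using block_map_paths[OF assms(2)] segment_in_paths[OF assms(1,3), of 0 "l + c"]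
    by (simp add: paths_def)
  then show "length (segment (block_code l c E \<psi> x) 0 l) = length (\<psi> (segment x 0 (l + c)))"
    by simp
qed (use assms(3) in \<open>auto simp: segment_def block_code_def simp del: upt_Suc\<close>)

text \<open>The extension to finite paths and the extension to infinite paths agree on prefixes.\<close>

lemma block_ext_segment:
  assumes "wf_digraph E" "block_map l c E F \<psi>" "x \<in> path_space E"
  shows "block_ext l c \<psi> (segment x 0 (l + c + i)) = segment (block_code l c E \<psi> x) 0 (l + i)"
proof -
  let ?y = "block_code l c E \<psi> x"
  have window: "take (1 + l + c) (drop j (segment x 0 (l + c + i))) = segment x j (j + (l + c))"
    if "j \<le> i" for j
    using take_drop_segment[of j "l + c" "l + c + i" x] that by simp
  have "take (1 + l + c) (segment x 0 (l + c + i)) = segment x 0 (l + c)"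
    using window[of 0] by simp
  moreover have "map (\<lambda>j. \<psi> (take (1 + l + c) (drop j (segment x 0 (l + c + i)))) ! l) [1..<Suc i]
      = map (\<lambda>j. ?y (l + j)) [1..<Suc i]"
    using assms(3) by (intro map_cong) (auto simp: window[simplified] block_code_shift simp del: upt_Suc)
  ultimately have "block_ext l c \<psi> (segment x 0 (l + c + i)) =
      segment ?y 0 l @ map (\<lambda>j. ?y (l + j)) [1..<Suc i]"
    by (simp add: block_ext_def segment_block_code[OF assms] del: upt_Suc)
  also have "\<dots> = segment ?y 0 (l + i)"
    by (intro nth_equalityI) (auto simp: segment_def nth_append simp del: upt_Suc)
  finally show ?thesis .
qed

text \<open>
  Two consecutive edges of the image lie either in the first block, which is a path, or are
  the last edges of the blocks of two consecutive windows, which compatibility joins.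
\<close>

lemma block_code_in_path_space:
  assumes "wf_digraph E" "wf_digraph F" "block_map l c E F \<psi>" "x \<in> path_space E"
  shows "block_code l c E \<psi> x \<in> path_space F"
proof -
  let ?y = "block_code l c E \<psi> x"
  have "\<psi> (segment x 0 (l + c)) \<in> paths F (Suc l)"
    using block_map_paths[OF assms(3)] segment_in_paths[OF assms(1,4), of 0 "l + c"] by simp
  then have "segment ?y 0 l \<in> paths F (Suc l)"
    using segment_block_code[OF assms(1,3,4)] by simp
  then have first: "\<And>i. i < l \<Longrightarrow> ?y i \<in> arcs F \<and> head F (?y i) = tail F (?y (Suc i))"
    by (auto simp: paths_Suc_iff[OF assms(2)] segment_def simp del: upt_Suc)
  have later: "?y (l + j) \<in> arcs F \<and> head F (?y (l + j)) = tail F (?y (Suc (l + j)))" for j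
  proof -
    let ?z = "(shift ^^ j) x"
    have "[\<psi> (segment ?z 0 (l + c)) ! l, \<psi> (segment ?z 1 (1 + l + c)) ! l] \<in> paths F 2"
      using assms(3) shift_funpow_in_path_space[OF assms(4)] by (auto simp: block_map_def)
    moreover have "segment ?z 1 (1 + l + c) = segment x (Suc j) (Suc j + (l + c))"
      using segment_shift_funpow[of 1 ?z "l + c"] segment_shift_funpow[of "Suc j" x "l + c"]
      by (simp add: funpow_swap1 add.assoc)
    ultimately have "[?y (l + j), ?y (l + Suc j)] \<in> paths F (Suc 1)"
      using block_code_shift[OF assms(4), of l c \<psi> j] block_code_shift[OF assms(4), of l c \<psi> "Suc j"]
      by (simp add: segment_shift_funpow numeral_2_eq_2)
    then show ?thesis
      by (auto simp: paths_Suc_iff[OF assms(2)] le_Suc_eq)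
  qed
  have "?y i \<in> arcs F \<and> head F (?y i) = tail F (?y (Suc i))" for i
    using first[of i] later[of "i - l"] by (cases "i < l") auto
  then show ?thesis by (auto simp: path_space_def)
qed

lemma block_code_prefix_determined:
  assumes "wf_digraph E" "block_map l c E F \<psi>" "x \<in> path_space E" "y \<in> path_space E"
    and "segment x 0 (l + c + i) = segment y 0 (l + c + i)"
  shows "segment (block_code l c E \<psi> x) 0 (l + i) = segment (block_code l c E \<psi> y) 0 (l + i)"
  using block_ext_segment[OF assms(1,2,3), of i] block_ext_segment[OF assms(1,2,4), of i] assms(5)
  by simp

lemma cylinder_segment: "cylinder E (segment x 0 n) = {y \<in> path_space E. segment y 0 n = segment x 0 n}"
  by (simp add: cylinder_def segment_def del: upt_Suc)

lemma continuity_constant_iff: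
  assumes "h \<in> path_space E \<rightarrow> path_space F"
  shows "continuity_constant l c E F h \<longleftrightarrow>
    (\<forall>k\<ge>l. \<forall>x\<in>path_space E. \<forall>y\<in>path_space E.
       segment y 0 (k + c) = segment x 0 (k + c) \<longrightarrow> segment (h y) 0 k = segment (h x) 0 k)"
  using assms unfolding continuity_constant_def cylinder_segment by (auto simp: image_subset_iff)

lemma block_code_sliding:
  assumes "wf_digraph E" "wf_digraph F" "block_map l c E F \<psi>"
  shows "sliding_block_code l E F (block_code l c E \<psi>)"
    and "continuity_constant l c E F (block_code l c E \<psi>)"
proof -
  let ?h = "block_code l c E \<psi>"
  have maps: "?h \<in> path_space E \<rightarrow> path_space F"
    using block_code_in_path_space[OF assms] by blast
  show const: "continuity_constant l c E F ?h"
  proof (subst continuity_constant_iff[OF maps], intro allI ballI impI)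
    fix k x y
    assume "l \<le> k" "x \<in> path_space E" "y \<in> path_space E"
      "segment y 0 (k + c) = segment x 0 (k + c)"
    then show "segment (?h y) 0 k = segment (?h x) 0 k"
      using block_code_prefix_determined[OF assms(1,3), of y x "k - l"]
      by (simp add: add.commute)
  qed
  have "continuous_map (path_topology E) (discrete_topology (arcs F)) (\<lambda>x. ?h x i)" for i
  proof (rule continuous_map_prefix_determined[where n = "l + c + i"])
    fix x y assume "x \<in> path_space E" "y \<in> path_space E"
      "segment x 0 (l + c + i) = segment y 0 (l + c + i)"
    then have "segment (?h x) 0 (l + i) = segment (?h y) 0 (l + i)"
      by (rule block_code_prefix_determined[OF assms(1,3)])
    then show "?h x i = ?h y i" by (auto simp: segment_eq_iff)
  qed (use maps in \<open>auto simp: path_space_def\<close>)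
  then have "continuous_map (path_topology E) (path_topology F) ?h"
    using maps
    by (subst (2) path_topology_def)
      (auto simp: continuous_map_in_subtopology continuous_map_componentwise_UNIV)
  moreover have "(shift ^^ (l + 1)) (?h x) = (shift ^^ l) (?h (shift x))" if "x \<in> path_space E" for x
  proof
    fix i
    have "shift x \<in> path_space E"
      using shift_funpow_in_path_space[OF that, of 1] by simp
    moreover have "segment (shift x) i (i + (l + c)) = segment x (Suc i) (Suc i + (l + c))"
      using segment_shift_funpow[of i "shift x" "l + c"] segment_shift_funpow[of "Suc i" x "l + c"]
      by (simp add: funpow_swap1)
    ultimately show "(shift ^^ (l + 1)) (?h x) i = (shift ^^ l) (?h (shift x)) i"
      using block_code_shift[OF that, of l c \<psi> "Suc i"] block_code_shift[of "shift x" E l c \<psi> i]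
      by (simp add: shift_funpow add.commute del: funpow.simps)
  qed
  moreover have "?h \<in> path_space E \<rightarrow>\<^sub>E path_space F"
  proof -
    have "?h \<in> extensional (path_space E)" by (simp add: block_code_def)
    with maps show ?thesis by (simp add: PiE_def)
  qed
  ultimately show "sliding_block_code l E F ?h"
    by (auto simp: sliding_block_code_def)
qed

lemma sliding_block_code_funpow:
  assumes "sliding_block_code l E F h" "x \<in> path_space E"
  shows "h x (l + j) = h ((shift ^^ j) x) l"
  using assms(2)
proof (induction j arbitrary: x)
  case (Suc j)
  have "(shift ^^ (l + 1)) (h x) j = (shift ^^ l) (h (shift x)) j"
    using assms(1) Suc.prems by (simp add: sliding_block_code_def)
  then have "h x (l + Suc j) = h (shift x) (l + j)"
    unfolding shift_funpow by (simp add: add.commute)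
  also have "h (shift x) (l + j) = h ((shift ^^ j) (shift x)) l"
    using Suc.IH shift_funpow_in_path_space[OF Suc.prems, of 1] by simp
  also have "(shift ^^ j) (shift x) = (shift ^^ Suc j) x"
    by (simp add: funpow_swap1)
  finally show ?case .
qed simp

text \<open>
  The continuity constant makes \<open>h(x)\<^sub>0 \<dots> h(x)\<^sub>l\<close> a function of the window \<open>x\<^sub>0 \<dots> x\<^bsub>l+c\<^esub>\<close>;
  that function is the block map. The shift relation gives all later edges from the windows
  further along \<open>x\<close>.
\<close>

lemma sliding_block_code_is_block_code:
  assumes "wf_digraph E" "wf_digraph F" "no_sinks E"
    and sliding: "sliding_block_code l E F h" and const: "continuity_constant l c E F h"
  obtains \<psi> where "block_map l c E F \<psi>" "block_code l c E \<psi> = h"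
proof -
  have ext: "h \<in> path_space E \<rightarrow>\<^sub>E path_space F"
    using sliding by (simp add: sliding_block_code_def)
  then have maps: "h \<in> path_space E \<rightarrow> path_space F" by (simp add: PiE_def)
  define lift where "lift p = (SOME x. x \<in> path_space E \<and> segment x 0 (l + c) = p)" for p
  define \<psi> where "\<psi> = (\<lambda>p\<in>paths E (Suc (l + c)). segment (h (lift p)) 0 l)"
  have lift: "lift p \<in> path_space E \<and> segment (lift p) 0 (l + c) = p"
    if p: "p \<in> paths E (Suc (l + c))" for p
  proof -
    obtain x where "x \<in> path_space E" "segment x 0 (l + c) = p"
      by (rule path_is_prefix[OF assms(1,3) p])
    then have "\<exists>x. x \<in> path_space E \<and> segment x 0 (l + c) = p" by blast
    then show ?thesis unfolding lift_def by (rule someI_ex)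
  qed
  have window: "\<psi> (segment x 0 (l + c)) = segment (h x) 0 l" if x: "x \<in> path_space E" for x
  proof -
    let ?p = "segment x 0 (l + c)"
    have p: "?p \<in> paths E (Suc (l + c))"
      using segment_in_paths[OF assms(1) x, of 0 "l + c"] by simp
    have "segment (h (lift ?p)) 0 l = segment (h x) 0 l"
      using const[unfolded continuity_constant_iff[OF maps], rule_format, of l x "lift ?p"] x lift[OF p]
      by simp
    then show ?thesis using p by (simp add: \<psi>_def)
  qed
  have edge: "\<psi> (segment x j (j + (l + c))) ! l = h x (l + j)" if x: "x \<in> path_space E" for x j
  proof -
    have "\<psi> (segment x j (j + (l + c))) ! l = segment (h ((shift ^^ j) x)) 0 l ! l"
      using window[OF shift_funpow_in_path_space[OF x]] by (simp add: segment_shift_funpow)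
    also have "\<dots> = h ((shift ^^ j) x) l"
      using segment_nth[of l l "h ((shift ^^ j) x)" 0] by simp
    finally show ?thesis using sliding_block_code_funpow[OF sliding x] by simp
  qed
  have "block_map l c E F \<psi>"
    unfolding block_map_def
  proof (intro conjI ballI)
    have "\<psi> p \<in> paths F (Suc l)" if "p \<in> paths E (Suc (l + c))" for p
      using segment_in_paths[OF assms(2), of "h (lift p)" 0 l] lift[OF that] maps that
      by (auto simp: \<psi>_def)
    then show "\<psi> \<in> paths E (1 + l + c) \<rightarrow>\<^sub>E paths F (1 + l)"
      by (auto simp: \<psi>_def)
  next
    fix x assume x: "x \<in> path_space E"
    have "h x \<in> path_space F" using maps x by blast
    then have "[h x l, h x (Suc l)] \<in> paths F (Suc 1)"
      by (auto simp: paths_Suc_iff[OF assms(2)] path_space_def le_Suc_eq)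
    then show "[\<psi> (segment x 0 (l + c)) ! l, \<psi> (segment x 1 (1 + l + c)) ! l] \<in> paths F 2"
      using edge[OF x, of 0] edge[OF x, of 1] by (simp add: numeral_2_eq_2 add.assoc)
  qed
  moreover have "block_code l c E \<psi> = h"
  proof
    fix x
    show "block_code l c E \<psi> x = h x"
    proof (cases "x \<in> path_space E")
      case True
      have "block_code l c E \<psi> x i = h x i" for i
      proof (cases "i \<le> l")
        case i: True
        then show ?thesis
          using True window[OF True] segment_nth[OF i, of "h x" 0] by (simp add: block_code_def)
      next
        case False
        then show ?thesis
          using block_code_shift[OF True, of l c \<psi> "i - l"] edge[OF True, of "i - l"] by simp
      qed
      then show ?thesis by blast
    next
      case False
      then show ?thesis using ext by (auto simp: block_code_def PiE_def extensional_def)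
    qed
  qed
  ultimately show thesis by (rule that)
qed

lemma bij_betw_block_code:
  assumes "wf_digraph E" "wf_digraph F" "no_sinks E"
  shows "bij_betw (block_code l c E) {\<psi>. block_map l c E F \<psi>}
    {h. sliding_block_code l E F h \<and> continuity_constant l c E F h}"
  unfolding bij_betw_def
proof (intro conjI inj_onI)
  fix \<psi> \<psi>' assume block: "\<psi> \<in> {\<psi>. block_map l c E F \<psi>}" "\<psi>' \<in> {\<psi>. block_map l c E F \<psi>}"
    and eq: "block_code l c E \<psi> = block_code l c E \<psi>'"
  show "\<psi> = \<psi>'"
  proof (rule PiE_ext)
    show "\<psi> \<in> paths E (1 + l + c) \<rightarrow>\<^sub>E paths F (1 + l)" "\<psi>' \<in> paths E (1 + l + c) \<rightarrow>\<^sub>E paths F (1 + l)"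
      using block by (auto simp: block_map_def)
    fix p assume "p \<in> paths E (1 + l + c)"
    then have "p \<in> paths E (Suc (l + c))" by simp
    then obtain x where "x \<in> path_space E" "segment x 0 (l + c) = p"
      by (rule path_is_prefix[OF assms(1,3)])
    then show "\<psi> p = \<psi>' p"
      using block eq segment_block_code[OF assms(1)] by (metis mem_Collect_eq)
  qed
next
  show "block_code l c E ` {\<psi>. block_map l c E F \<psi>} =
      {h. sliding_block_code l E F h \<and> continuity_constant l c E F h}"
    using block_code_sliding[OF assms(1,2)] sliding_block_code_is_block_code[OF assms]
    by (auto simp: image_iff) metis
qed

section \<open>Bijectivity\<close>

lemma bij_betw_from_conditions:
  assumes "fin_digraph E" "wf_digraph F" "no_sinks E"
    and block: "block_map l c E F \<psi>" and bij: "bijectivity_condition l c E F \<psi>"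
  shows "bij_betw (block_code l c E \<psi>) (path_space E) (path_space F)"
proof -
  let ?h = "block_code l c E \<psi>"
  have wf: "wf_digraph E" "wf_digraph F"
    using assms(1,2) by (simp_all add: fin_digraph_def)
  have fin: "finite (arcs E)"
    using assms(1) by (rule fin_digraph.finite_arcs)
  have "continuous_map (path_topology E) (path_topology F) ?h"
    using block_code_sliding(1)[OF wf block] by (simp add: sliding_block_code_def)
  note surj = surj_from_prefixes[OF fin this, of l]
  have "x = x'" if x: "x \<in> path_space E" "x' \<in> path_space E" and eq: "?h x = ?h x'" for x x'
  proof
    fix i
    obtain K where "l + c \<le> l + i + K" and K: "\<forall>x\<in>path_space E. \<forall>x'\<in>path_space E.
        block_ext l c \<psi> (segment x 0 (l + i + K)) = block_ext l c \<psi> (segment x' 0 (l + i + K)) \<longrightarrow>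
        segment x 0 (l + i) = segment x' 0 (l + i)"
      using bij unfolding bijectivity_condition_def injectivity_condition_def
      by (meson le_add1)
    then obtain m where m: "l + i + K = l + c + m" by (metis le_Suc_ex)
    have "block_ext l c \<psi> (segment x 0 (l + i + K)) = block_ext l c \<psi> (segment x' 0 (l + i + K))"
      unfolding m block_ext_segment[OF wf(1) block x(1)] block_ext_segment[OF wf(1) block x(2)]
      using eq by simp
    then have "segment x 0 (l + i) = segment x' 0 (l + i)"
      using K x by blast
    then show "x i = x' i" by (simp add: segment_eq_iff)
  qed
  moreover have "y \<in> ?h ` path_space E" if y: "y \<in> path_space F" for y
  proof -
    have "\<exists>x\<in>path_space E. segment (?h x) 0 k = segment y 0 k" if k: "l \<le> k" for k
    proof -
      have "segment y 0 k \<in> paths F (1 + k)"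
        using segment_in_paths[OF wf(2) y, of 0 k] by simp
      then obtain \<alpha> where "\<alpha> \<in> paths E (1 + k + c)" and \<alpha>: "block_ext l c \<psi> \<alpha> = segment y 0 k"
        using bij k unfolding bijectivity_condition_def surjectivity_condition_def by blast
      then have "\<alpha> \<in> paths E (Suc (l + c + (k - l)))" using k by (simp add: add.commute)
      then obtain x where "x \<in> path_space E" "segment x 0 (l + c + (k - l)) = \<alpha>"
        by (rule path_is_prefix[OF wf(1) assms(3)])
      then show ?thesis
        using \<alpha> k block_ext_segment[OF wf(1) block, of x "k - l"] by auto
    qed
    then show ?thesis using surj by blast
  qed
  ultimately show ?thesis
    using block_code_in_path_space[OF wf block] by (auto simp: bij_betw_def inj_on_def)
qed

lemma conditions_from_bij_betw:
  assumes "fin_digraph E" "wf_digraph F" "no_sinks F"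
    and block: "block_map l c E F \<psi>"
    and bij: "bij_betw (block_code l c E \<psi>) (path_space E) (path_space F)"
  shows "bijectivity_condition l c E F \<psi>"
proof -
  let ?h = "block_code l c E \<psi>"
  have wf: "wf_digraph E" "wf_digraph F"
    using assms(1,2) by (simp_all add: fin_digraph_def)
  have fin: "finite (arcs E)"
    using assms(1) by (rule fin_digraph.finite_arcs)
  have cont: "continuous_map (path_topology E) (path_topology F) ?h"
    using block_code_sliding(1)[OF wf block] by (simp add: sliding_block_code_def)
  have "surjectivity_condition l c E F \<psi>"
    unfolding surjectivity_condition_def
  proof (intro allI impI ballI)
    fix k \<beta> assume k: "l \<le> k" and "\<beta> \<in> paths F (1 + k)"
    then have "\<beta> \<in> paths F (Suc k)" by simp
    then obtain y where y: "y \<in> path_space F" "segment y 0 k = \<beta>"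
      by (rule path_is_prefix[OF wf(2) assms(3)])
    have "y \<in> ?h ` path_space E"
      using bij y(1) by (simp add: bij_betw_def)
    then obtain x where x: "x \<in> path_space E" "?h x = y" by blast
    have "block_ext l c \<psi> (segment x 0 (k + c)) = \<beta>"
      using block_ext_segment[OF wf(1) block x(1), of "k - l"] x y k by (simp add: add.commute)
    moreover have "segment x 0 (k + c) \<in> paths E (1 + k + c)"
      using segment_in_paths[OF wf(1) x(1), of 0 "k + c"] by simp
    ultimately show "\<exists>\<alpha>\<in>paths E (1 + k + c). block_ext l c \<psi> \<alpha> = \<beta>" by blast
  qed
  moreover have "injectivity_condition l c E \<psi>"
    unfolding injectivity_condition_def
  proof (intro allI impI)
    fix k assume k: "l \<le> k"
    obtain n where n: "\<And>x x'. \<lbrakk>x \<in> path_space E; x' \<in> path_space E;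
        segment (?h x) 0 n = segment (?h x') 0 n\<rbrakk> \<Longrightarrow> segment x 0 k = segment x' 0 k"
      using inj_recovers_prefix[OF fin cont, of k] bij by (auto simp: bij_betw_def)
    \<comment> \<open>A path of \<open>1 + k + (c + n)\<close> edges has an image of \<open>1 + k + n\<close> edges, at least the \<open>1 + n\<close> needed.\<close>
    have prefix: "segment x 0 k = segment x' 0 k"
      if x: "x \<in> path_space E" "x' \<in> path_space E"
        and eq: "block_ext l c \<psi> (segment x 0 (k + (c + n))) =
          block_ext l c \<psi> (segment x' 0 (k + (c + n)))" for x x'
    proof -
      have len: "k + (c + n) = l + c + (k - l + n)" using k by simp
      have "segment (?h x) 0 (l + (k - l + n)) = segment (?h x') 0 (l + (k - l + n))"
        using eq unfolding len
          block_ext_segment[OF wf(1) block x(1)] block_ext_segment[OF wf(1) block x(2)] .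
      then have "segment (?h x) 0 n = segment (?h x') 0 n"
        by (rule segment_eq_mono) simp
      then show ?thesis using n x by blast
    qed
    show "\<exists>K. l + c \<le> k + K \<and> (\<forall>x\<in>path_space E. \<forall>x'\<in>path_space E.
        block_ext l c \<psi> (segment x 0 (k + K)) = block_ext l c \<psi> (segment x' 0 (k + K)) \<longrightarrow>
        segment x 0 k = segment x' 0 k)"
    proof (intro exI[of _ "c + n"] conjI ballI impI)
      show "l + c \<le> k + (c + n)" using k by simp
    qed (rule prefix)
  qed
  ultimately show ?thesis by (simp add: bijectivity_condition_def)
qed

section \<open>Block maps with an inverse block map\<close>

lemma block_code_inverse:
  assumes "wf_digraph E" "wf_digraph F"
    and "block_map l 0 E F \<psi>" "block_map l 0 F E \<phi>"
    and inv: "\<And>i \<alpha>. \<alpha> \<in> paths E (1 + l + i) \<Longrightarrow> block_ext l 0 \<phi> (block_ext l 0 \<psi> \<alpha>) = \<alpha>"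
    and x: "x \<in> path_space E"
  shows "block_code l 0 F \<phi> (block_code l 0 E \<psi> x) = x"
proof
  fix i
  let ?y = "block_code l 0 E \<psi> x"
  have y: "?y \<in> path_space F"
    using block_code_in_path_space[OF assms(1-3) x] .
  have "segment (block_code l 0 F \<phi> ?y) 0 (l + i) =
      block_ext l 0 \<phi> (block_ext l 0 \<psi> (segment x 0 (l + i)))"
    using block_ext_segment[OF assms(2,4) y, of i] block_ext_segment[OF assms(1,3) x, of i] by simp
  also have "\<dots> = segment x 0 (l + i)"
    using inv[of _ i] segment_in_paths[OF assms(1) x, of 0 "l + i"] by simp
  finally show "block_code l 0 F \<phi> ?y i = x i"
    by (simp add: segment_eq_iff)
qed

lemma block_ext_inverse:
  assumes "wf_digraph E" "wf_digraph F" "no_sinks E"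
    and "block_map l 0 E F \<psi>" "block_map l 0 F E \<phi>"
    and inv: "\<And>x. x \<in> path_space E \<Longrightarrow> block_code l 0 F \<phi> (block_code l 0 E \<psi> x) = x"
    and \<alpha>: "\<alpha> \<in> paths E (1 + l + i)"
  shows "block_ext l 0 \<phi> (block_ext l 0 \<psi> \<alpha>) = \<alpha>"
proof -
  have "\<alpha> \<in> paths E (Suc (l + i))" using \<alpha> by simp
  then obtain x where x: "x \<in> path_space E" "segment x 0 (l + i) = \<alpha>"
    by (rule path_is_prefix[OF assms(1,3)])
  have "block_code l 0 E \<psi> x \<in> path_space F"
    using block_code_in_path_space[OF assms(1,2,4) x(1)] .
  then show ?thesis
    using block_ext_segment[OF assms(1,4) x(1), of i] x inv
      block_ext_segment[OF assms(2,5), of "block_code l 0 E \<psi> x" i] by simp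
qed

lemma block_ext_block:
  assumes "\<alpha> \<in> paths E (1 + l)"
  shows "block_ext l 0 \<psi> \<alpha> = \<psi> \<alpha>"
  using assms by (simp add: block_ext_def paths_def)

lemma inverse_map_eqI:
  assumes "h \<in> path_space E \<rightarrow> path_space F" "g \<in> path_space F \<rightarrow>\<^sub>E path_space E"
    and "\<And>x. x \<in> path_space E \<Longrightarrow> g (h x) = x" "\<And>y. y \<in> path_space F \<Longrightarrow> h (g y) = y"
  shows "inverse_map E F h = g"
proof -
  have inj: "inj_on h (path_space E)"
    by (intro inj_on_inverseI[of _ g] assms(3))
  have "inv_into (path_space E) h y = g y" if "y \<in> path_space F" for y
    using inv_into_f_eq[OF inj, of "g y" y] assms(2,4) that by auto
  then show ?thesis
    using assms(2) by (intro extensionalityI[of _ "path_space F"]) (auto simp: inverse_map_def PiE_def)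
qed

lemma conjugacies_from_bijective_block_map:
  assumes "wf_digraph E" "wf_digraph F" and bij: "bijective_block_map l E F \<psi>"
  shows "conjugacy l 0 E F (block_code l 0 E \<psi>)"
    and "conjugacy l 0 F E (inverse_map E F (block_code l 0 E \<psi>))"
proof -
  define \<phi> where "\<phi> = restrict (inv_into (paths E (1 + l)) \<psi>) (paths F (1 + l))"
  have \<psi>: "block_map l 0 E F \<psi>" and \<phi>: "block_map l 0 F E \<phi>"
    and inv: "\<And>i \<alpha>. \<alpha> \<in> paths E (1 + l + i) \<Longrightarrow> block_ext l 0 \<phi> (block_ext l 0 \<psi> \<alpha>) = \<alpha>"
      "\<And>i \<beta>. \<beta> \<in> paths F (1 + l + i) \<Longrightarrow> block_ext l 0 \<psi> (block_ext l 0 \<phi> \<beta>) = \<beta>"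
    using bij unfolding bijective_block_map_def Let_def \<phi>_def by blast+
  let ?h = "block_code l 0 E \<psi>" and ?g = "block_code l 0 F \<phi>"
  have gh: "?g (?h x) = x" if "x \<in> path_space E" for x
    using block_code_inverse[OF assms(1,2) \<psi> \<phi> inv(1) that] .
  have hg: "?h (?g y) = y" if "y \<in> path_space F" for y
    using block_code_inverse[OF assms(2,1) \<phi> \<psi> inv(2) that] .
  have h: "sliding_block_code l E F ?h" "continuity_constant l 0 E F ?h"
    by (fact block_code_sliding[OF assms(1,2) \<psi>])+
  have g: "sliding_block_code l F E ?g" "continuity_constant l 0 F E ?g"
    by (fact block_code_sliding[OF assms(2,1) \<phi>])+
  have maps: "?h \<in> path_space E \<rightarrow> path_space F" "?g \<in> path_space F \<rightarrow>\<^sub>E path_space E"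
    using h g by (auto simp: sliding_block_code_def)
  have "inverse_map E F ?h = ?g"
    by (rule inverse_map_eqI[OF maps gh hg])
  moreover have "bij_betw ?h (path_space E) (path_space F)"
    by (rule bij_betw_byWitness[where f' = ?g]) (use gh hg maps in auto)
  moreover have "bij_betw ?g (path_space F) (path_space E)"
    by (rule bij_betw_byWitness[where f' = ?h]) (use gh hg maps in auto)
  ultimately show "conjugacy l 0 E F ?h" "conjugacy l 0 F E (inverse_map E F ?h)"
    using h g by (simp_all add: conjugacy_def)
qed

text \<open>
  The inverse conjugacy is itself the code of a block map, and comparing prefixes shows that
  this block map inverts \<open>\<psi>\<close> on paths of every length.
\<close>

lemma bijective_block_map_from_conjugacies:
  assumes "wf_digraph E" "wf_digraph F" "no_sinks E" "no_sinks F"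
    and \<psi>: "block_map l 0 E F \<psi>"
    and h: "conjugacy l 0 E F (block_code l 0 E \<psi>)"
    and g: "conjugacy l 0 F E (inverse_map E F (block_code l 0 E \<psi>))"
  shows "bijective_block_map l E F \<psi>"
proof -
  let ?h = "block_code l 0 E \<psi>" and ?P = "paths E (1 + l)" and ?Q = "paths F (1 + l)"
  obtain \<phi> where \<phi>: "block_map l 0 F E \<phi>" and code: "block_code l 0 F \<phi> = inverse_map E F ?h"
    using g sliding_block_code_is_block_code[OF assms(2,1,4)] unfolding conjugacy_def by metis
  have bij: "bij_betw ?h (path_space E) (path_space F)"
    using h by (simp add: conjugacy_def)
  have gh: "block_code l 0 F \<phi> (?h x) = x" if "x \<in> path_space E" for x
    using bij that unfolding code by (auto simp: inverse_map_def bij_betw_def)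
  have hg: "?h (block_code l 0 F \<phi> y) = y" if "y \<in> path_space F" for y
    using bij that unfolding code by (simp add: inverse_map_def bij_betw_inv_into_right)
  have ext: "\<And>i \<alpha>. \<alpha> \<in> paths E (1 + l + i) \<Longrightarrow> block_ext l 0 \<phi> (block_ext l 0 \<psi> \<alpha>) = \<alpha>"
      "\<And>i \<beta>. \<beta> \<in> paths F (1 + l + i) \<Longrightarrow> block_ext l 0 \<psi> (block_ext l 0 \<phi> \<beta>) = \<beta>"
    using block_ext_inverse[OF assms(1,2,3) \<psi> \<phi> gh] block_ext_inverse[OF assms(2,1,4) \<phi> \<psi> hg]
    by blast+
  have maps: "\<psi> \<in> ?P \<rightarrow> ?Q" "\<phi> \<in> ?Q \<rightarrow>\<^sub>E ?P"
    using \<psi> \<phi> by (auto simp: block_map_def)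
  have \<phi>\<psi>: "\<phi> (\<psi> \<alpha>) = \<alpha>" if "\<alpha> \<in> ?P" for \<alpha>
  proof -
    have "\<psi> \<alpha> \<in> ?Q" using maps(1) that by (rule funcset_mem)
    then show ?thesis
      using ext(1)[of \<alpha> 0] block_ext_block[of \<alpha> E l \<psi>] block_ext_block[of "\<psi> \<alpha>" F l \<phi>] that
      by simp
  qed
  have \<psi>\<phi>: "\<psi> (\<phi> \<beta>) = \<beta>" if "\<beta> \<in> ?Q" for \<beta>
  proof -
    have "\<phi> \<beta> \<in> ?P" using maps(2) that by (rule PiE_mem)
    then show ?thesis
      using ext(2)[of \<beta> 0] block_ext_block[of \<beta> F l \<phi>] block_ext_block[of "\<phi> \<beta>" E l \<psi>] that
      by simp
  qed
  have inj: "inj_on \<psi> ?P"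
    by (intro inj_on_inverseI[of _ \<phi>] \<phi>\<psi>)
  have "inv_into ?P \<psi> \<beta> = \<phi> \<beta>" if "\<beta> \<in> ?Q" for \<beta>
    using inv_into_f_eq[OF inj, of "\<phi> \<beta>" \<beta>] maps \<psi>\<phi> that by auto
  then have "restrict (inv_into ?P \<psi>) ?Q = \<phi>"
    using maps by (intro extensionalityI[of _ ?Q]) (auto simp: PiE_def)
  moreover have "bij_betw \<psi> ?P ?Q"
    by (rule bij_betw_byWitness[where f' = \<phi>]) (use \<phi>\<psi> \<psi>\<phi> maps in auto)
  ultimately show ?thesis
    using \<psi> \<phi> ext unfolding bijective_block_map_def Let_def by simp
qed

section \<open>The correspondences\<close>

lemma bij_betw_Collect:
  assumes "bij_betw f A B" "\<And>a. a \<in> A \<Longrightarrow> P a \<longleftrightarrow> Q (f a)"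
  shows "bij_betw f {a \<in> A. P a} {b \<in> B. Q b}"
  using assms unfolding bij_betw_def inj_on_def by blast

theorem corollary3p9:
  fixes E :: "('a,'b) pre_digraph" and F :: "('c,'d) pre_digraph" and l c :: nat
  assumes "fin_digraph E" and "fin_digraph F" and "no_sinks E" and "no_sinks F"
  shows "bij_betw (block_code l c E)
           {\<psi>. block_map l c E F \<psi> \<and> bijectivity_condition l c E F \<psi>}
           {h. conjugacy l c E F h} \<and>
         bij_betw (block_code l 0 E)
           {\<psi>. bijective_block_map l E F \<psi>}
           {h. conjugacy l 0 E F h \<and> conjugacy l 0 F E (inverse_map E F h)}"
proof
  have wf: "wf_digraph E" "wf_digraph F"
    using assms(1,2) by (simp_all add: fin_digraph_def)
  note codes = bij_betw_block_code[OF wf assms(3)]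
  have "bij_betw (block_code l c E)
      {\<psi> \<in> {\<psi>. block_map l c E F \<psi>}. bijectivity_condition l c E F \<psi>}
      {h \<in> {h. sliding_block_code l E F h \<and> continuity_constant l c E F h}.
        bij_betw h (path_space E) (path_space F)}"
    using bij_betw_from_conditions[OF assms(1) wf(2) assms(3)]
      conditions_from_bij_betw[OF assms(1) wf(2) assms(4)]
    by (intro bij_betw_Collect[OF codes]) blast
  then show "bij_betw (block_code l c E)
      {\<psi>. block_map l c E F \<psi> \<and> bijectivity_condition l c E F \<psi>} {h. conjugacy l c E F h}"
    by (simp add: conjugacy_def conj_assoc)
  have "bij_betw (block_code l 0 E)
      {\<psi> \<in> {\<psi>. block_map l 0 E F \<psi>}. bijective_block_map l E F \<psi>}
      {h \<in> {h. sliding_block_code l E F h \<and> continuity_constant l 0 E F h}.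
        conjugacy l 0 E F h \<and> conjugacy l 0 F E (inverse_map E F h)}"
    using conjugacies_from_bijective_block_map[OF wf]
      bijective_block_map_from_conjugacies[OF wf assms(3,4)]
    by (intro bij_betw_Collect[OF codes]) blast
  moreover have "{\<psi> \<in> {\<psi>. block_map l 0 E F \<psi>}. bijective_block_map l E F \<psi>} =
      {\<psi>. bijective_block_map l E F \<psi>}"
    unfolding bijective_block_map_def by blast
  moreover have "{h \<in> {h. sliding_block_code l E F h \<and> continuity_constant l 0 E F h}.
        conjugacy l 0 E F h \<and> conjugacy l 0 F E (inverse_map E F h)} =
      {h. conjugacy l 0 E F h \<and> conjugacy l 0 F E (inverse_map E F h)}"
    unfolding conjugacy_def by blast
  ultimately show "bij_betw (block_code l 0 E) {\<psi>. bijective_block_map l E F \<psi>}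
      {h. conjugacy l 0 E F h \<and> conjugacy l 0 F E (inverse_map E F h)}"
    by simp
qed

end
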